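(* Let $n\ge 2$, $N=\binom{n}{2}$, and let $F$ be a fundamental basic block with exactly $n$ reducible elements and nullity $\eta(F)=N$ (denoted $\mathrm{CF}(n)$). Let $u_1<u_2<\cdots<u_n$ be its reducible elements. Then $F$ has the adjunct representation $$F = C_0\,]^{u_2}_{u_1}\{c_1\}\,]^{u_3}_{u_1}\{c_2\}\cdots]^{u_n}_{u_1}\{c_{n-1}\}\,]^{u_3}_{u_2}\{c_n\}\cdots]^{u_j}_{u_i}\{c_k\}\cdots]^{u_n}_{u_{n-1}}\{c_N\},$$ in which every adjunct chain is a singleton $\{c_k\}$, the adjunct pairs are exactly the pairs $(u_i,u_j)$ with $1\le i<j\le n$, each occurring once, the pair $(u_i,u_j)$ carrying $\{c_k\}$ with $k=(i-1)n-\binom{i}{2}+j-i$, and $C_0$ is the maximal chain $u_1\prec x_1\prec u_2\prec x_2\prec\cdots\prec u_{n-1}\prec x_{n-1}\prec u_n$, where $x_i\parallel c_k$ for $k=(i-1)n-\binom{i}{2}+1$ (the element attached to the pair $(u_i,u_{i+1})$). Consequently $|F|=2n-1+\binom{n}{2}$, $F$ has $(2n-2)+2\binom{n}{2}$ coverings, and $\eta(F)=\binom n2$.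
   Context: For a finite poset $P$, $a\prec b$ means $b$ covers $a$; the nullity $\eta(P)$ is $|E|-|V|+c$ for the cover graph of $P$ (undirected graph on $P$ with edges the coverings), $c$ its number of components. $x\parallel y$ means $x,y$ incomparable. An element $x$ of a lattice is join-reducible (meet-reducible) if $x=y\vee z$ ($x=y\wedge z$) for some $y,z$ both different from $x$; reducible if join- or meet-reducible. An element of a poset is doubly irreducible if it has at most one upper cover and at most one lower cover. Adjunct operation: for disjoint lattices $L_1,L_2$ and $a<b$ in $L_1$ with $a\not\prec b$, $L_1\,]_a^b\,L_2$ is $L_1\cup L_2$ ordered by: $x\le y$ iff $x\le y$ within $L_1$ or within $L_2$, or $x\in L_1$, $y\in L_2$, $x\le a$, or $x\in L_2$, $y\in L_1$, $b\le y$; $(a,b)$ is the adjunct pair. An RC-lattice is a finite lattice whose reducible elements are pairwise comparable; every RC-lattice is dismantlable and hence an adjunct of chains $C_0\,]_{a_1}^{b_1}C_1\cdots]_{a_r}^{b_r}C_r$ with $C_0$ a maximal chain, the representation being unique up to the order of the adjunct pairs. A poset $B$ is a basic block if it has one element, or has no doubly irreducible elements, or removal of (any) doubly irreducible element from $B$ reduces its nullity by one. A fundamental basic block is an RC-lattice that is a basic block and in whose adjunct representation all adjunct pairs are distinct. *)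

theory Defs
  imports Main
begin

text \<open>Finite posets are represented by a carrier set V together with an order
relation le (only its restriction to V matters).\<close>

type_synonym 'a poset = "'a set \<times> ('a \<Rightarrow> 'a \<Rightarrow> bool)"

definition partial_order_on :: "'a set \<Rightarrow> ('a \<Rightarrow> 'a \<Rightarrow> bool) \<Rightarrow> bool" where
  "partial_order_on V le \<longleftrightarrow>
     (\<forall>x\<in>V. le x x) \<and>
     (\<forall>x\<in>V. \<forall>y\<in>V. le x y \<and> le y x \<longrightarrow> x = y) \<and>
     (\<forall>x\<in>V. \<forall>y\<in>V. \<forall>z\<in>V. le x y \<and> le y z \<longrightarrow> le x z)"

definition covers :: "'a set \<Rightarrow> ('a \<Rightarrow> 'a \<Rightarrow> bool) \<Rightarrow> 'a \<Rightarrow> 'a \<Rightarrow> bool" where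
  "covers V le a b \<longleftrightarrow> a \<in> V \<and> b \<in> V \<and> le a b \<and> a \<noteq> b \<and>
     \<not> (\<exists>z\<in>V. le a z \<and> le z b \<and> z \<noteq> a \<and> z \<noteq> b)"

definition incomparable :: "('a \<Rightarrow> 'a \<Rightarrow> bool) \<Rightarrow> 'a \<Rightarrow> 'a \<Rightarrow> bool" where
  "incomparable le x y \<longleftrightarrow> \<not> le x y \<and> \<not> le y x"

definition coverings :: "'a set \<Rightarrow> ('a \<Rightarrow> 'a \<Rightarrow> bool) \<Rightarrow> ('a \<times> 'a) set" where
  "coverings V le = {(a, b). covers V le a b}"

definition cover_edges :: "'a set \<Rightarrow> ('a \<Rightarrow> 'a \<Rightarrow> bool) \<Rightarrow> 'a set set" where
  "cover_edges V le = {{a, b} | a b. covers V le a b}"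

definition cover_conn :: "'a set \<Rightarrow> ('a \<Rightarrow> 'a \<Rightarrow> bool) \<Rightarrow> ('a \<times> 'a) set" where
  "cover_conn V le =
     ({(a, b). covers V le a b \<or> covers V le b a})\<^sup>* \<inter> (V \<times> V)"

definition num_components :: "'a set \<Rightarrow> ('a \<Rightarrow> 'a \<Rightarrow> bool) \<Rightarrow> nat" where
  "num_components V le = card (V // cover_conn V le)"

definition nullity :: "'a set \<Rightarrow> ('a \<Rightarrow> 'a \<Rightarrow> bool) \<Rightarrow> int" where
  "nullity V le = int (card (cover_edges V le)) - int (card V) + int (num_components V le)"

definition is_lub :: "'a set \<Rightarrow> ('a \<Rightarrow> 'a \<Rightarrow> bool) \<Rightarrow> 'a \<Rightarrow> 'a \<Rightarrow> 'a \<Rightarrow> bool" where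
  "is_lub V le x y z \<longleftrightarrow> z \<in> V \<and> le x z \<and> le y z \<and> (\<forall>w\<in>V. le x w \<and> le y w \<longrightarrow> le z w)"

definition is_glb :: "'a set \<Rightarrow> ('a \<Rightarrow> 'a \<Rightarrow> bool) \<Rightarrow> 'a \<Rightarrow> 'a \<Rightarrow> 'a \<Rightarrow> bool" where
  "is_glb V le x y z \<longleftrightarrow> z \<in> V \<and> le z x \<and> le z y \<and> (\<forall>w\<in>V. le w x \<and> le w y \<longrightarrow> le w z)"

definition finite_lattice :: "'a set \<Rightarrow> ('a \<Rightarrow> 'a \<Rightarrow> bool) \<Rightarrow> bool" where
  "finite_lattice V le \<longleftrightarrow> finite V \<and> V \<noteq> {} \<and> partial_order_on V le \<and>
     (\<forall>x\<in>V. \<forall>y\<in>V. (\<exists>z. is_lub V le x y z) \<and> (\<exists>z. is_glb V le x y z))"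

definition join_reducible :: "'a set \<Rightarrow> ('a \<Rightarrow> 'a \<Rightarrow> bool) \<Rightarrow> 'a \<Rightarrow> bool" where
  "join_reducible V le x \<longleftrightarrow> (\<exists>y\<in>V. \<exists>z\<in>V. y \<noteq> x \<and> z \<noteq> x \<and> is_lub V le y z x)"

definition meet_reducible :: "'a set \<Rightarrow> ('a \<Rightarrow> 'a \<Rightarrow> bool) \<Rightarrow> 'a \<Rightarrow> bool" where
  "meet_reducible V le x \<longleftrightarrow> (\<exists>y\<in>V. \<exists>z\<in>V. y \<noteq> x \<and> z \<noteq> x \<and> is_glb V le y z x)"

definition reducible :: "'a set \<Rightarrow> ('a \<Rightarrow> 'a \<Rightarrow> bool) \<Rightarrow> 'a \<Rightarrow> bool" where
  "reducible V le x \<longleftrightarrow> join_reducible V le x \<or> meet_reducible V le x"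

definition reducibles :: "'a set \<Rightarrow> ('a \<Rightarrow> 'a \<Rightarrow> bool) \<Rightarrow> 'a set" where
  "reducibles V le = {x \<in> V. reducible V le x}"

definition doubly_irreducible :: "'a set \<Rightarrow> ('a \<Rightarrow> 'a \<Rightarrow> bool) \<Rightarrow> 'a \<Rightarrow> bool" where
  "doubly_irreducible V le x \<longleftrightarrow> x \<in> V \<and>
     card {y. covers V le x y} \<le> 1 \<and> card {y. covers V le y x} \<le> 1"

definition basic_block :: "'a set \<Rightarrow> ('a \<Rightarrow> 'a \<Rightarrow> bool) \<Rightarrow> bool" where
  "basic_block V le \<longleftrightarrow> card V = 1 \<or>
     (\<forall>x\<in>V. \<not> doubly_irreducible V le x) \<or>
     (\<forall>x. doubly_irreducible V le x \<longrightarrow> nullity (V - {x}) le = nullity V le - 1)"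

definition RC_lattice :: "'a set \<Rightarrow> ('a \<Rightarrow> 'a \<Rightarrow> bool) \<Rightarrow> bool" where
  "RC_lattice V le \<longleftrightarrow> finite_lattice V le \<and>
     (\<forall>x\<in>reducibles V le. \<forall>y\<in>reducibles V le. le x y \<or> le y x)"

definition is_chain :: "('a \<Rightarrow> 'a \<Rightarrow> bool) \<Rightarrow> 'a set \<Rightarrow> bool" where
  "is_chain le S \<longleftrightarrow> (\<forall>x\<in>S. \<forall>y\<in>S. le x y \<or> le y x)"

definition maximal_chain :: "'a set \<Rightarrow> ('a \<Rightarrow> 'a \<Rightarrow> bool) \<Rightarrow> 'a set \<Rightarrow> bool" where
  "maximal_chain V le S \<longleftrightarrow> S \<subseteq> V \<and> is_chain le S \<and>
     (\<forall>T. S \<subset> T \<and> T \<subseteq> V \<longrightarrow> \<not> is_chain le T)"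

text \<open>A chain is given as a list listing its elements from bottom to top.\<close>
definition chain_le :: "'a list \<Rightarrow> 'a \<Rightarrow> 'a \<Rightarrow> bool" where
  "chain_le C x y \<longleftrightarrow> (\<exists>i j. i \<le> j \<and> j < length C \<and> C ! i = x \<and> C ! j = y)"

definition chain_poset :: "'a list \<Rightarrow> 'a poset" where
  "chain_poset C = (set C, chain_le C)"

definition adjunct :: "'a poset \<Rightarrow> 'a \<Rightarrow> 'a \<Rightarrow> 'a list \<Rightarrow> 'a poset" where
  "adjunct P a b C =
     (fst P \<union> set C,
      \<lambda>x y. (x \<in> fst P \<and> y \<in> fst P \<and> snd P x y) \<or>
            (x \<in> set C \<and> y \<in> set C \<and> chain_le C x y) \<or>
            (x \<in> fst P \<and> y \<in> set C \<and> snd P x a) \<or>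
            (x \<in> set C \<and> y \<in> fst P \<and> snd P b y))"

fun adj_iter :: "'a poset \<Rightarrow> ('a \<times> 'a \<times> 'a list) list \<Rightarrow> 'a poset" where
  "adj_iter P [] = P"
| "adj_iter P ((a, b, C) # s) = adj_iter (adjunct P a b C) s"

fun adj_valid :: "'a poset \<Rightarrow> ('a \<times> 'a \<times> 'a list) list \<Rightarrow> bool" where
  "adj_valid P [] = True"
| "adj_valid P ((a, b, C) # s) \<longleftrightarrow>
     a \<in> fst P \<and> b \<in> fst P \<and> snd P a b \<and> a \<noteq> b \<and> \<not> covers (fst P) (snd P) a b \<and>
     C \<noteq> [] \<and> distinct C \<and> set C \<inter> fst P = {} \<and>
     adj_valid (adjunct P a b C) s"

definition adj_rep :: "'a set \<Rightarrow> ('a \<Rightarrow> 'a \<Rightarrow> bool) \<Rightarrow> 'a list \<Rightarrow> ('a \<times> 'a \<times> 'a list) list \<Rightarrow> bool" where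
  "adj_rep V le C0 steps \<longleftrightarrow>
     C0 \<noteq> [] \<and> distinct C0 \<and> maximal_chain V le (set C0) \<and>
     adj_valid (chain_poset C0) steps \<and>
     fst (adj_iter (chain_poset C0) steps) = V \<and>
     (\<forall>x\<in>V. \<forall>y\<in>V. snd (adj_iter (chain_poset C0) steps) x y = le x y)"

definition adj_pairs :: "('a \<times> 'a \<times> 'a list) list \<Rightarrow> ('a \<times> 'a) list" where
  "adj_pairs steps = map (\<lambda>(a, b, C). (a, b)) steps"

definition fundamental_basic_block :: "'a set \<Rightarrow> ('a \<Rightarrow> 'a \<Rightarrow> bool) \<Rightarrow> bool" where
  "fundamental_basic_block V le \<longleftrightarrow> RC_lattice V le \<and> basic_block V le \<and>
     (\<exists>C0 steps. adj_rep V le C0 steps \<and> distinct (adj_pairs steps))"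

definition pair_index :: "nat \<Rightarrow> nat \<Rightarrow> nat \<Rightarrow> nat" where
  "pair_index n i j = (i - 1) * n - (i choose 2) + (j - i)"

definition CF_chain :: "nat \<Rightarrow> (nat \<Rightarrow> 'a) \<Rightarrow> (nat \<Rightarrow> 'a) \<Rightarrow> 'a list" where
  "CF_chain n u x = concat (map (\<lambda>i. [u i, x i]) [1..<n]) @ [u n]"

definition CF_steps :: "nat \<Rightarrow> (nat \<Rightarrow> 'a) \<Rightarrow> (nat \<Rightarrow> 'a) \<Rightarrow> ('a \<times> 'a \<times> 'a list) list" where
  "CF_steps n u c = concat (map (\<lambda>i. map (\<lambda>j. (u i, u j, [c (pair_index n i j)])) [Suc i..<Suc n]) [1..<n])"

end

theory Submission
  imports Defs
begin

text \<open>
  In a basic block every irreducible element x has exactly one lower cover p and one upper cover q: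
  otherwise deleting x would not lower the nullity. The same count gives a second element strictly
  between p and q, which forces p and q to be reducible. Hence the lattice consists of the chain
  u 1 < ... < u n together with, for each i < j, the links of (u i, u j): the irreducible elements
  that cover u i and are covered by u j.

  Join two elements of an open interval by an edge if they are comparable. Adjoining a chain at
  (a, b) raises the number of components of the interval between a and b by one, and that of no
  other interval. Since the adjunct pairs are distinct, every open interval has at most two
  components. A link of (p, q) is a component by itself, so there are at most two links, and at most
  one if some u k lies strictly between p and q.

  With m irreducible elements and t coverings u i < u (i + 1), the nullity is m + t - n + 1. The
  value n choose 2 is therefore attained only if all bounds are equalities and t = 0: two links for each
  (u i, u (i + 1)) and one for every other pair. One of the two links of (u i, u (i + 1)) goes into
  the base chain, and all remaining links are adjoined as singletons.
\<close>

section \<open>Finite posets and lattices\<close>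

definition less_on :: "'a set \<Rightarrow> ('a \<Rightarrow> 'a \<Rightarrow> bool) \<Rightarrow> 'a \<Rightarrow> 'a \<Rightarrow> bool" where
  "less_on V le x y \<longleftrightarrow> x \<in> V \<and> y \<in> V \<and> le x y \<and> x \<noteq> y"

definition open_interval :: "'a set \<Rightarrow> ('a \<Rightarrow> 'a \<Rightarrow> bool) \<Rightarrow> 'a \<Rightarrow> 'a \<Rightarrow> 'a set" where
  "open_interval V le p q = {z. less_on V le p z \<and> less_on V le z q}"

definition irreducibles :: "'a set \<Rightarrow> ('a \<Rightarrow> 'a \<Rightarrow> bool) \<Rightarrow> 'a set" where
  "irreducibles V le = V - reducibles V le"

lemma reducibles_Un_irreducibles: "reducibles V le \<union> irreducibles V le = V"
  by (auto simp: irreducibles_def reducibles_def)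

lemma reducibles_Int_irreducibles: "reducibles V le \<inter> irreducibles V le = {}"
  by (auto simp: irreducibles_def)

lemma covers_iff_open_interval_empty:
  "covers V le a b \<longleftrightarrow> less_on V le a b \<and> open_interval V le a b = {}"
  by (auto simp: covers_def less_on_def open_interval_def)

lemma covers_imp_less_on: "covers V le a b \<Longrightarrow> less_on V le a b"
  by (simp add: covers_iff_open_interval_empty)

lemma upper_covers_comparable_eq:
  assumes "covers V le p a" "covers V le p b" "le a b \<or> le b a"
  shows "a = b"
  using assms unfolding covers_def by blast

lemma less_on_conversep [simp]: "less_on V le\<inverse>\<inverse> x y \<longleftrightarrow> less_on V le y x"
  by (auto simp: less_on_def)

lemma covers_conversep [simp]: "covers V le\<inverse>\<inverse> a b \<longleftrightarrow> covers V le b a"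
  by (auto simp: covers_def)

lemma open_interval_conversep [simp]: "open_interval V le\<inverse>\<inverse> p q = open_interval V le q p"
  by (auto simp: open_interval_def)

lemma is_glb_conversep [simp]: "is_glb V le\<inverse>\<inverse> x y z \<longleftrightarrow> is_lub V le x y z"
  by (simp add: is_glb_def is_lub_def)

lemma is_lub_conversep [simp]: "is_lub V le\<inverse>\<inverse> x y z \<longleftrightarrow> is_glb V le x y z"
  by (simp add: is_glb_def is_lub_def)

lemma irreducibles_conversep [simp]: "irreducibles V le\<inverse>\<inverse> = irreducibles V le"
  by (auto simp: irreducibles_def reducibles_def reducible_def join_reducible_def meet_reducible_def)

locale poset =
  fixes V :: "'a set" and le :: "'a \<Rightarrow> 'a \<Rightarrow> bool"
  assumes partial_order: "partial_order_on V le"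
begin

lemma le_refl: "x \<in> V \<Longrightarrow> le x x"
  using partial_order unfolding partial_order_on_def by blast

lemma le_antisym: "le x y \<Longrightarrow> le y x \<Longrightarrow> x \<in> V \<Longrightarrow> y \<in> V \<Longrightarrow> x = y"
  using partial_order unfolding partial_order_on_def by blast

lemma le_trans: "le x y \<Longrightarrow> le y z \<Longrightarrow> x \<in> V \<Longrightarrow> y \<in> V \<Longrightarrow> z \<in> V \<Longrightarrow> le x z"
  using partial_order unfolding partial_order_on_def by blast

lemma less_on_le_trans: "less_on V le x y \<Longrightarrow> le y z \<Longrightarrow> z \<in> V \<Longrightarrow> less_on V le x z"
  unfolding less_on_def by (metis le_antisym le_trans)

lemma le_less_on_trans: "le x y \<Longrightarrow> less_on V le y z \<Longrightarrow> x \<in> V \<Longrightarrow> less_on V le x z"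
  unfolding less_on_def by (metis le_antisym le_trans)

lemma less_on_trans: "less_on V le x y \<Longrightarrow> less_on V le y z \<Longrightarrow> less_on V le x z"
  using less_on_le_trans unfolding less_on_def by blast

lemma transp_less_on: "transp (less_on V le)"
  by (rule transpI) (rule less_on_trans)

lemma asymp_less_on: "asymp (less_on V le)"
  by (rule asympI) (metis le_antisym less_on_def)

lemma poset_conversep: "poset V le\<inverse>\<inverse>"
  using partial_order unfolding poset_def partial_order_on_def conversep_iff by blast

lemma poset_subset: "W \<subseteq> V \<Longrightarrow> poset W le"
  using partial_order unfolding poset_def partial_order_on_def by blast

lemma covers_remove_between:
  assumes "open_interval V le p q = {x}"
  shows "covers (V - {x}) le p q"
proof -
  have "less_on V le p x" "less_on V le x q"
    using assms by (auto simp: open_interval_def)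
  then have "less_on (V - {x}) le p q"
    using less_on_trans[of p x q] by (auto simp: less_on_def)
  moreover have "open_interval (V - {x}) le p q \<subseteq> open_interval V le p q - {x}"
    by (auto simp: open_interval_def less_on_def)
  ultimately show ?thesis
    using assms by (simp add: covers_iff_open_interval_empty)
qed

end

locale finite_poset = poset +
  assumes finite_carrier: "finite V"
begin

lemma finite_covers: "finite {z. covers V le x z}" "finite {z. covers V le z x}"
  by (rule finite_subset[OF _ finite_carrier], auto simp: covers_def)+

lemma finite_coverings: "finite (coverings V le)"
  by (rule finite_subset[of _ "V \<times> V"]) (auto simp: coverings_def covers_def finite_carrier)

lemma finite_poset_conversep: "finite_poset V le\<inverse>\<inverse>"
  using poset_conversep finite_carrier by (simp add: finite_poset_def finite_poset_axioms_def)

lemma finite_poset_subset: "W \<subseteq> V \<Longrightarrow> finite_poset W le"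
  using poset_subset finite_carrier
  by (auto simp: finite_poset_def finite_poset_axioms_def intro: finite_subset)

lemma exists_minimal:
  assumes "S \<subseteq> V" "S \<noteq> {}"
  obtains m where "m \<in> S" "\<And>x. x \<in> S \<Longrightarrow> \<not> less_on V le x m"
proof -
  have "asymp_on S (less_on V le)" "transp_on S (less_on V le)"
    using asymp_less_on transp_less_on by (auto intro: asymp_on_subset transp_on_subset)
  moreover have "finite S"
    using assms(1) finite_carrier by (rule finite_subset)
  ultimately show thesis
    using Finite_Set.bex_min_element[of S "less_on V le"] assms(2) that by (metis less_on_def)
qed

lemma exists_upper_cover:
  assumes "less_on V le a b"
  obtains p where "covers V le a p" "le p b"
proof -
  let ?S = "{z. less_on V le a z \<and> le z b}"
  have "b \<in> ?S" "?S \<subseteq> V"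
    using assms le_refl by (auto simp: less_on_def)
  then obtain p where p: "p \<in> ?S" "\<And>z. z \<in> ?S \<Longrightarrow> \<not> less_on V le z p"
    using exists_minimal[of ?S] by blast
  have "open_interval V le a p = {}"
  proof (rule equals0I)
    fix z assume z: "z \<in> open_interval V le a p"
    then have "less_on V le z p"
      by (simp add: open_interval_def)
    moreover from this have "less_on V le z b"
      using less_on_le_trans p(1) assms unfolding less_on_def by blast
    ultimately show False
      using p(2)[of z] z by (simp add: open_interval_def less_on_def)
  qed
  then have "covers V le a p"
    using p(1) by (simp add: covers_iff_open_interval_empty)
  then show thesis
    using that p(1) by blast
qed

lemma exists_lower_cover:
  assumes "less_on V le a b"
  obtains p where "covers V le p b" "le a p"
  using finite_poset.exists_upper_cover[OF finite_poset_conversep, of b a] assms by auto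

lemma card_cover_edges: "card (cover_edges V le) = card (coverings V le)"
proof -
  have "cover_edges V le = (\<lambda>(a, b). {a, b}) ` coverings V le"
    by (auto simp: cover_edges_def coverings_def)
  moreover have "inj_on (\<lambda>(a, b). {a, b}) (coverings V le)"
    by (rule inj_onI) (auto simp: coverings_def covers_def doubleton_eq_iff dest: le_antisym)
  ultimately show ?thesis
    by (simp add: card_image)
qed

lemma num_components_pos:
  assumes "V \<noteq> {}"
  shows "1 \<le> num_components V le"
proof -
  have "V // cover_conn V le \<noteq> {}"
    using assms by (auto simp: quotient_def)
  then show ?thesis
    by (simp add: num_components_def Suc_le_eq card_gt_0_iff quotient_def finite_carrier)
qed

lemma least_covers_rtrancl:
  assumes "m \<in> V" "\<And>x. x \<in> V \<Longrightarrow> le m x" "x \<in> V"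
  shows "(m, x) \<in> (coverings V le)\<^sup>*"
proof (rule ccontr)
  let ?S = "{x \<in> V. (m, x) \<notin> (coverings V le)\<^sup>*}"
  assume "(m, x) \<notin> (coverings V le)\<^sup>*"
  then obtain s where s: "s \<in> ?S" "\<And>y. y \<in> ?S \<Longrightarrow> \<not> less_on V le y s"
    using exists_minimal[of ?S] assms(3) by blast
  then have "less_on V le m s"
    using assms(1,2) by (auto simp: less_on_def)
  then obtain p where p: "covers V le p s"
    by (rule exists_lower_cover)
  then have "(m, p) \<in> (coverings V le)\<^sup>*"
    using s(2)[of p] by (auto simp: covers_iff_open_interval_empty less_on_def)
  moreover have "(p, s) \<in> coverings V le"
    using p by (simp add: coverings_def)
  ultimately have "(m, s) \<in> (coverings V le)\<^sup>*"
    by (rule rtrancl_into_rtrancl)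
  then show False
    using s(1) by simp
qed

lemma num_components_least:
  assumes "m \<in> V" "\<And>x. x \<in> V \<Longrightarrow> le m x"
  shows "num_components V le = 1"
proof -
  let ?R = "{(a, b). covers V le a b \<or> covers V le b a}"
  have from_least: "(m, x) \<in> ?R\<^sup>*" if "x \<in> V" for x
    using least_covers_rtrancl[OF assms that] rtrancl_mono[of "coverings V le" ?R]
    by (auto simp: coverings_def)
  have "sym (?R\<^sup>*)"
    by (rule sym_rtrancl) (auto simp: sym_def)
  then have "(x, y) \<in> ?R\<^sup>*" if "x \<in> V" "y \<in> V" for x y
    using from_least that by (meson rtrancl_trans symD)
  then have "cover_conn V le `` {x} = V" if "x \<in> V" for x
    using that unfolding cover_conn_def by blast
  then have "V // cover_conn V le = {V}"
    using assms(1) by (auto simp: quotient_def)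
  then show ?thesis
    by (simp add: num_components_def)
qed

end

locale lattice_poset =
  fixes V :: "'a set" and le :: "'a \<Rightarrow> 'a \<Rightarrow> bool"
  assumes finite_lattice: "finite_lattice V le"

sublocale lattice_poset \<subseteq> finite_poset
  using finite_lattice by unfold_locales (simp_all add: finite_lattice_def)

context lattice_poset
begin

lemma exists_glb: "x \<in> V \<Longrightarrow> y \<in> V \<Longrightarrow> \<exists>z. is_glb V le x y z"
  using finite_lattice by (simp add: finite_lattice_def)

lemma lattice_poset_conversep: "lattice_poset V le\<inverse>\<inverse>"
  using finite_lattice poset.partial_order[OF poset_conversep]
  by (simp add: lattice_poset_def finite_lattice_def)

lemma exists_least: "\<exists>m\<in>V. \<forall>x\<in>V. le m x"
proof -
  have "V \<noteq> {}"
    using finite_lattice by (simp add: finite_lattice_def)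
  then obtain m where m: "m \<in> V" "\<And>x. x \<in> V \<Longrightarrow> \<not> less_on V le x m"
    using exists_minimal[of V] by blast
  have "le m x" if x: "x \<in> V" for x
  proof -
    obtain z where "z \<in> V" "le z m" "le z x"
      using exists_glb[OF m(1) x] by (auto simp: is_glb_def)
    then show ?thesis
      using m by (auto simp: less_on_def)
  qed
  then show ?thesis
    using m(1) by blast
qed

lemma num_components_eq_1: "num_components V le = 1"
  using exists_least num_components_least by blast

lemma irreducible_upper_covers_eq:
  assumes x: "x \<in> irreducibles V le" and y: "covers V le x y" and z: "covers V le x z"
  shows "y = z"
proof (rule ccontr)
  assume "y \<noteq> z"
  have yz: "y \<in> V" "z \<in> V" "le x y" "le x z" "y \<noteq> x" "z \<noteq> x"
    using y z by (auto simp: covers_def)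
  obtain g where g: "is_glb V le y z g"
    using exists_glb yz by blast
  then have "g \<in> V" "le x g" "le g y" "le g z"
    using yz x by (auto simp: is_glb_def irreducibles_def)
  then have "g = x"
    using y z \<open>y \<noteq> z\<close> unfolding covers_def by blast
  then have "x \<in> reducibles V le"
    using g yz x unfolding irreducibles_def reducibles_def reducible_def meet_reducible_def by blast
  then show False
    using x by (simp add: irreducibles_def)
qed

lemma irreducible_lower_covers_eq:
  "x \<in> irreducibles V le \<Longrightarrow> covers V le y x \<Longrightarrow> covers V le z x \<Longrightarrow> y = z"
  using lattice_poset.irreducible_upper_covers_eq[OF lattice_poset_conversep] by simp

lemma irreducible_upper_cover_le:
  assumes "x \<in> irreducibles V le" "covers V le x y" "less_on V le x z"
  shows "le y z"
  using exists_upper_cover[OF assms(3)] irreducible_upper_covers_eq[OF assms(1,2)] by metis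

lemma irreducible_le_lower_cover:
  "x \<in> irreducibles V le \<Longrightarrow> covers V le y x \<Longrightarrow> less_on V le z x \<Longrightarrow> le z y"
  using lattice_poset.irreducible_upper_cover_le[OF lattice_poset_conversep] by simp

lemma irreducible_imp_doubly_irreducible:
  assumes "x \<in> irreducibles V le"
  shows "doubly_irreducible V le x"
  using assms irreducible_upper_covers_eq irreducible_lower_covers_eq finite_covers[of x]
  by (auto simp: doubly_irreducible_def irreducibles_def card_le_Suc0_iff_eq)

end

section \<open>Basic blocks\<close>

context finite_poset
begin

lemma card_coverings_le_remove:
  "card (coverings V le) \<le> card (coverings V le \<inter> coverings (V - {x}) le) +
     (card {z. covers V le z x} + card {z. covers V le x z})"
proof -
  let ?kept = "coverings V le \<inter> coverings (V - {x}) le"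
  let ?below = "(\<lambda>z. (z, x)) ` {z. covers V le z x}" and ?above = "Pair x ` {z. covers V le x z}"
  have "coverings V le \<subseteq> ?kept \<union> (?below \<union> ?above)"
    by (auto simp: coverings_def covers_def)
  then have "card (coverings V le) \<le> card (?kept \<union> (?below \<union> ?above))"
    using finite_coverings finite_covers by (intro card_mono) auto
  also have "\<dots> \<le> card ?kept + (card ?below + card ?above)"
    by (intro order_trans[OF card_Un_le] add_left_mono card_Un_le)
  also have "\<dots> = card ?kept + (card {z. covers V le z x} + card {z. covers V le x z})"
    by (simp add: card_image inj_on_def)
  finally show ?thesis .
qed

lemma nullity_remove_imp_card_coverings:
  assumes "nullity (V - {x}) le = nullity V le - 1" "num_components V le = 1" "x \<in> V" "V \<noteq> {x}"
  shows "card (coverings (V - {x}) le) + 2 \<le> card (coverings V le)"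
proof -
  interpret removed: finite_poset "V - {x}" le
    by (rule finite_poset_subset) blast
  have "1 \<le> num_components (V - {x}) le"
    using assms by (intro removed.num_components_pos) blast
  moreover have "int (card (V - {x})) = int (card V) - 1"
    using card_Suc_Diff1[OF finite_carrier assms(3)] by simp
  ultimately show ?thesis
    using assms(1,2) unfolding nullity_def card_cover_edges removed.card_cover_edges by linarith
qed

text \<open>Deleting x destroys at most one covering below and one above x, and creates the covering (p, q)
  unless another element lies between p and q.\<close>

lemma nullity_remove_imp_unique_covers:
  assumes x: "doubly_irreducible V le x" and "num_components V le = 1" "V \<noteq> {x}"
    and "nullity (V - {x}) le = nullity V le - 1"
  obtains p q where "{z. covers V le z x} = {p}" "{z. covers V le x z} = {q}"
    "open_interval V le p q \<noteq> {x}"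
proof -
  interpret removed: finite_poset "V - {x}" le
    by (rule finite_poset_subset) blast
  let ?kept = "coverings V le \<inter> coverings (V - {x}) le"
  have x_in: "x \<in> V" and few: "card {z. covers V le z x} \<le> 1" "card {z. covers V le x z} \<le> 1"
    using x by (auto simp: doubly_irreducible_def)
  have lost: "card (coverings (V - {x}) le) + 2 \<le> card (coverings V le)"
    using assms x_in by (intro nullity_remove_imp_card_coverings)
  have "card ?kept \<le> card (coverings (V - {x}) le)"
    using removed.finite_coverings by (intro card_mono) auto
  then have one: "card {z. covers V le z x} = 1" "card {z. covers V le x z} = 1"
    and kept: "card ?kept = card (coverings (V - {x}) le)"
    using lost few card_coverings_le_remove[of x] by linarith+
  obtain p q where pq: "{z. covers V le z x} = {p}" "{z. covers V le x z} = {q}"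
    using one by (auto simp: card_1_singleton_iff)
  have "open_interval V le p q \<noteq> {x}"
  proof
    assume "open_interval V le p q = {x}"
    then have "(p, q) \<in> coverings (V - {x}) le" "(p, q) \<notin> coverings V le"
      using covers_remove_between by (auto simp: coverings_def covers_iff_open_interval_empty)
    then have "?kept \<subset> coverings (V - {x}) le"
      by blast
    then show False
      using psubset_card_mono[OF removed.finite_coverings, of ?kept] kept by simp
  qed
  then show thesis
    using that pq by blast
qed

end

text \<open>If the lower cover p of x were irreducible, x would be its only upper cover and no
  second element could lie strictly between p and the upper cover of x.\<close>

lemma (in lattice_poset) basic_block_irreducible_covers:
  assumes bb: "basic_block V le" and "V \<noteq> {x}" and x: "x \<in> irreducibles V le"
  obtains p q where "p \<in> reducibles V le" "q \<in> reducibles V le"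
    "{z. covers V le z x} = {p}" "{z. covers V le x z} = {q}"
proof -
  have dirr: "doubly_irreducible V le x"
    using x by (rule irreducible_imp_doubly_irreducible)
  moreover have "nullity (V - {x}) le = nullity V le - 1"
    using bb \<open>V \<noteq> {x}\<close> dirr unfolding basic_block_def doubly_irreducible_def
    by (metis card_1_singletonE singletonD)
  ultimately obtain p q where pq: "{z. covers V le z x} = {p}" "{z. covers V le x z} = {q}"
    and "open_interval V le p q \<noteq> {x}"
    using nullity_remove_imp_unique_covers num_components_eq_1 \<open>V \<noteq> {x}\<close> by metis
  then have px: "covers V le p x" and xq: "covers V le x q"
    by auto
  then have "x \<in> open_interval V le p q"
    by (simp add: open_interval_def covers_imp_less_on)
  then obtain y where y: "less_on V le p y" "less_on V le y q" "y \<noteq> x"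
    using \<open>open_interval V le p q \<noteq> {x}\<close> by (auto simp: open_interval_def)
  have "\<not> le x y" "\<not> le y x"
    using px xq y by (auto simp: covers_def less_on_def)
  then have "p \<notin> irreducibles V le" "q \<notin> irreducibles V le"
    using irreducible_upper_cover_le[OF _ px y(1)] irreducible_le_lower_cover[OF _ xq y(2)] by blast+
  then have "p \<in> reducibles V le" "q \<in> reducibles V le"
    using px xq by (auto simp: irreducibles_def covers_def)
  then show thesis
    using that pq by blast
qed

section \<open>Comparability components\<close>

definition comparability_conn :: "('a \<Rightarrow> 'a \<Rightarrow> bool) \<Rightarrow> 'a set \<Rightarrow> ('a \<times> 'a) set" where
  "comparability_conn le S = {(x, y). x \<in> S \<and> y \<in> S \<and> (le x y \<or> le y x)}\<^sup>*"

definition components_le :: "('a \<Rightarrow> 'a \<Rightarrow> bool) \<Rightarrow> 'a set \<Rightarrow> nat \<Rightarrow> bool" where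
  "components_le le S m \<longleftrightarrow>
     (\<exists>F. finite F \<and> card F \<le> m \<and> (\<forall>x\<in>S. \<exists>f\<in>F. (x, f) \<in> comparability_conn le S))"

lemma components_le_conversep [simp]: "components_le le\<inverse>\<inverse> S m \<longleftrightarrow> components_le le S m"
  by (simp add: components_le_def comparability_conn_def disj_commute)

lemma comparability_conn_mono: "S \<subseteq> T \<Longrightarrow> comparability_conn le S \<subseteq> comparability_conn le T"
  unfolding comparability_conn_def by (rule rtrancl_mono) blast

lemma comparable_imp_conn:
  "x \<in> S \<Longrightarrow> y \<in> S \<Longrightarrow> le x y \<or> le y x \<Longrightarrow> (x, y) \<in> comparability_conn le S"
  unfolding comparability_conn_def by (rule r_into_rtrancl) simp

lemma components_le_mono: "components_le le S m \<Longrightarrow> m \<le> m' \<Longrightarrow> components_le le S m'"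
  unfolding components_le_def by (meson le_trans)

lemma components_le_empty: "components_le le {} 0"
  unfolding components_le_def by (rule exI[of _ "{}"]) simp

lemma components_le_comparable:
  assumes "z \<in> S" "\<And>x. x \<in> S \<Longrightarrow> le x z \<or> le z x"
  shows "components_le le S 1"
proof -
  have "(x, z) \<in> comparability_conn le S" if "x \<in> S" for x
    using that assms by (intro comparable_imp_conn) auto
  then show ?thesis
    unfolding components_le_def by (intro exI[of _ "{z}"]) simp
qed

lemma components_le_chain:
  assumes "is_chain le S"
  shows "components_le le S 1"
proof (cases "S = {}")
  case True
  then show ?thesis
    using components_le_empty by (auto intro: components_le_mono)
next
  case False
  then show ?thesis
    using assms components_le_comparable unfolding is_chain_def by (metis ex_in_conv)
qed

lemma components_le_Un:
  assumes "components_le le S m" "components_le le T k"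
  shows "components_le le (S \<union> T) (m + k)"
proof -
  obtain F where F: "finite F" "card F \<le> m" "\<And>x. x \<in> S \<Longrightarrow> \<exists>f\<in>F. (x, f) \<in> comparability_conn le S"
    using assms(1) unfolding components_le_def by blast
  obtain G where G: "finite G" "card G \<le> k" "\<And>x. x \<in> T \<Longrightarrow> \<exists>g\<in>G. (x, g) \<in> comparability_conn le T"
    using assms(2) unfolding components_le_def by blast
  have "card (F \<union> G) \<le> m + k"
    using card_Un_le[of F G] F(2) G(2) by linarith
  moreover have "\<exists>f\<in>F \<union> G. (x, f) \<in> comparability_conn le (S \<union> T)" if "x \<in> S \<union> T" for x
    using that F(3) G(3) comparability_conn_mono[of S "S \<union> T" le]
      comparability_conn_mono[of T "S \<union> T" le]
    by blast
  ultimately show ?thesis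
    using F(1) G(1) unfolding components_le_def by (intro exI[of _ "F \<union> G"]) blast
qed

lemma components_le_Un_comparable:
  assumes "components_le le S m" "z \<in> S" "\<And>c. c \<in> C \<Longrightarrow> le c z \<or> le z c"
  shows "components_le le (S \<union> C) m"
proof -
  obtain F where F: "finite F" "card F \<le> m" "\<And>x. x \<in> S \<Longrightarrow> \<exists>f\<in>F. (x, f) \<in> comparability_conn le S"
    using assms(1) unfolding components_le_def by blast
  have from_S: "\<exists>f\<in>F. (x, f) \<in> comparability_conn le (S \<union> C)" if "x \<in> S" for x
    using that F(3) comparability_conn_mono[of S "S \<union> C" le] by blast
  have from_C: "\<exists>f\<in>F. (x, f) \<in> comparability_conn le (S \<union> C)" if "x \<in> C" for x
  proof -
    obtain f where "f \<in> F" "(z, f) \<in> comparability_conn le (S \<union> C)"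
      using from_S assms(2) by blast
    moreover have "(x, z) \<in> comparability_conn le (S \<union> C)"
      using that assms(2,3) by (intro comparable_imp_conn) auto
    ultimately show ?thesis
      unfolding comparability_conn_def by (meson rtrancl_trans)
  qed
  show ?thesis
    using F(1,2) from_S from_C unfolding components_le_def by blast
qed

lemma isolated_conn_eq:
  assumes "(x, f) \<in> comparability_conn le S" "\<And>y. y \<in> S \<Longrightarrow> le x y \<or> le y x \<Longrightarrow> y = x"
  shows "f = x"
  using assms(1) unfolding comparability_conn_def
  by (induction rule: rtrancl_induct) (use assms(2) in blast)+

lemma card_isolated_le_components:
  assumes "components_le le S m" and X: "X \<subseteq> S"
    and isolated: "\<And>x y. x \<in> X \<Longrightarrow> y \<in> S \<Longrightarrow> le x y \<or> le y x \<Longrightarrow> y = x"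
  shows "card X + of_bool (X \<noteq> S) \<le> m"
proof -
  obtain F where F: "finite F" "card F \<le> m" "\<And>x. x \<in> S \<Longrightarrow> \<exists>f\<in>F. (x, f) \<in> comparability_conn le S"
    using assms(1) unfolding components_le_def by blast
  have X_F: "X \<subseteq> F"
  proof
    fix x assume x: "x \<in> X"
    then obtain f where "f \<in> F" "(x, f) \<in> comparability_conn le S"
      using F(3) X by blast
    then show "x \<in> F"
      using isolated_conn_eq isolated x by metis
  qed
  show ?thesis
  proof (cases "X = S")
    case True
    then show ?thesis
      using card_mono[OF F(1) X_F] F(2) by simp
  next
    case False
    then obtain r f where r: "r \<in> S" "r \<notin> X" "f \<in> F" "(r, f) \<in> comparability_conn le S"
      using X F(3) by blast
    have "sym (comparability_conn le S)"
      unfolding comparability_conn_def by (rule sym_rtrancl) (auto simp: sym_def)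
    then have "(f, r) \<in> comparability_conn le S"
      using r(4) by (rule symD)
    then have "f \<notin> X"
      using isolated_conn_eq[of f r] isolated r(2) by metis
    then have "card X < card F"
      using X_F r(3) F(1) by (intro psubset_card_mono) auto
    then show ?thesis
      using F(2) False by simp
  qed
qed

section \<open>Adjuncts of chains\<close>

definition represents :: "'a poset \<Rightarrow> 'a set \<Rightarrow> ('a \<Rightarrow> 'a \<Rightarrow> bool) \<Rightarrow> bool" where
  "represents P V le \<longleftrightarrow> fst P = V \<and> (\<forall>x\<in>V. \<forall>y\<in>V. snd P x y = le x y)"

definition attached :: "('a \<Rightarrow> 'a \<Rightarrow> bool) \<Rightarrow> 'a set \<Rightarrow> 'a \<Rightarrow> 'a \<Rightarrow> 'a set \<Rightarrow> bool" where
  "attached le W a b C \<longleftrightarrow> (\<forall>w\<in>W. \<forall>c\<in>C. (le w c \<longleftrightarrow> le w a) \<and> (le c w \<longleftrightarrow> le b w))"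

lemma represents_adjunct_iff:
  assumes "a \<in> fst P" "b \<in> fst P" "set C \<inter> fst P = {}"
  shows "represents (adjunct P a b C) V le \<longleftrightarrow>
    V = fst P \<union> set C \<and> represents P (fst P) le \<and> represents (chain_poset C) (set C) le \<and>
    attached le (fst P) a b (set C)"
    (is "?adjunct \<longleftrightarrow> ?V \<and> ?P \<and> ?C \<and> ?attached")
proof (cases ?V)
  case True
  let ?le' = "snd (adjunct P a b C)"
  have base_le: "?le' v w = snd P v w" if "v \<in> fst P" "w \<in> fst P" for v w
    using that assms(3) by (auto simp: adjunct_def)
  have chain_le: "?le' c d = chain_le C c d" if "c \<in> set C" "d \<in> set C" for c d
    using that assms(3) by (auto simp: adjunct_def)
  have mixed_le: "?le' w c = snd P w a" "?le' c w = snd P b w" if "w \<in> fst P" "c \<in> set C" for w c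
    using that assms(3) by (auto simp: adjunct_def)
  have "?adjunct \<longleftrightarrow> (\<forall>x\<in>V. \<forall>y\<in>V. ?le' x y = le x y)"
    using True by (simp add: represents_def adjunct_def)
  also have "\<dots> \<longleftrightarrow> (\<forall>x\<in>fst P. \<forall>y\<in>fst P. ?le' x y = le x y) \<and>
      (\<forall>x\<in>set C. \<forall>y\<in>set C. ?le' x y = le x y) \<and>
      (\<forall>w\<in>fst P. \<forall>c\<in>set C. (le w c \<longleftrightarrow> ?le' w c) \<and> (le c w \<longleftrightarrow> ?le' c w))"
    unfolding True ball_Un by blast
  also have "\<dots> \<longleftrightarrow> ?P \<and> ?C \<and> (\<forall>w\<in>fst P. \<forall>c\<in>set C. (le w c \<longleftrightarrow> snd P w a) \<and> (le c w \<longleftrightarrow> snd P b w))"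
    by (simp add: represents_def chain_poset_def base_le chain_le mixed_le eq_commute cong: ball_cong)
  also have "\<dots> \<longleftrightarrow> ?P \<and> ?C \<and> ?attached"
    using assms(1,2) unfolding represents_def attached_def by blast
  finally show ?thesis
    using True by simp
qed (auto simp: represents_def adjunct_def)

lemma is_chain_if_represents:
  assumes "represents (chain_poset C) V le"
  shows "is_chain le V"
proof -
  have "chain_le C x y \<or> chain_le C y x" if "x \<in> set C" "y \<in> set C" for x y
    using that unfolding chain_le_def in_set_conv_nth by (metis nle_le)
  then show ?thesis
    using assms unfolding represents_def chain_poset_def is_chain_def by auto
qed

lemma distinct_if_sorted_wrt_less_on: "sorted_wrt (less_on V le) C \<Longrightarrow> distinct C"
  by (induction C) (auto simp: less_on_def)

lemma (in poset) represents_chain_poset: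
  assumes sorted: "sorted_wrt (less_on V le) C" and carrier: "set C \<subseteq> V"
  shows "represents (chain_poset C) (set C) le"
proof -
  have mono: "le (C ! i) (C ! j)" if "i \<le> j" "j < length C" for i j
    using that sorted_wrt_nth_less[OF sorted, of i j] le_refl[OF subsetD[OF carrier nth_mem[of j]]]
    by (cases "i = j") (auto simp: less_on_def)
  have "chain_le C a b \<longleftrightarrow> le a b" if ab: "a \<in> set C" "b \<in> set C" for a b
  proof
    assume "chain_le C a b"
    then show "le a b"
      using mono by (auto simp: chain_le_def)
  next
    assume "le a b"
    obtain i j where ij: "i < length C" "j < length C" "C ! i = a" "C ! j = b"
      using ab unfolding in_set_conv_nth by blast
    have "\<not> less_on V le b a"
      using \<open>le a b\<close> le_antisym by (auto simp: less_on_def)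
    then have "i \<le> j"
      using sorted_wrt_nth_less[OF sorted, of j i] ij by force
    then show "chain_le C a b"
      using ij by (auto simp: chain_le_def)
  qed
  then show ?thesis
    by (simp add: represents_def chain_poset_def)
qed

lemma adj_iter_append: "adj_iter P (s @ t) = adj_iter (adj_iter P s) t"
  by (induction P s rule: adj_iter.induct) auto

lemma adj_valid_append: "adj_valid P (s @ t) \<longleftrightarrow> adj_valid P s \<and> adj_valid (adj_iter P s) t"
  by (induction P s rule: adj_valid.induct) auto

locale adjunct_poset = poset V le for V :: "'a set" and le +
  fixes W C :: "'a set" and a b :: 'a
  assumes carrier: "V = W \<union> C" and disjoint: "W \<inter> C = {}" and chain: "is_chain le C"
    and pair: "a \<in> W" "b \<in> W" "le a b" "a \<noteq> b"
    and attached: "attached le W a b C"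
begin

lemma below_iff: "w \<in> W \<Longrightarrow> c \<in> C \<Longrightarrow> le w c \<longleftrightarrow> le w a"
  and above_iff: "w \<in> W \<Longrightarrow> c \<in> C \<Longrightarrow> le c w \<longleftrightarrow> le b w"
  using attached by (simp_all add: attached_def)

lemma open_interval_base:
  assumes "p \<in> W" "q \<in> W"
  shows "open_interval V le p q =
    open_interval W le p q \<union> (if le p a \<and> le b q then C else {})"
  using assms below_iff above_iff carrier disjoint by (auto simp: open_interval_def less_on_def)

text \<open>An interval properly containing the one between a and b contains a or b, to which every element
  of the new chain is comparable.\<close>

lemma components_le_open_interval_base:
  assumes "p \<in> W" "q \<in> W" "components_le le (open_interval W le p q) m"
  shows "components_le le (open_interval V le p q) (m + of_bool ((p, q) = (a, b)))"
proof (cases "le p a \<and> le b q")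
  case False
  then have "(p, q) \<noteq> (a, b)"
    using le_refl pair carrier by blast
  then show ?thesis
    using assms False by (auto simp: open_interval_base)
next
  case True
  show ?thesis
  proof (cases "(p, q) = (a, b)")
    case True
    then show ?thesis
      using components_le_Un[OF assms(3) components_le_chain[OF chain]] assms \<open>le p a \<and> le b q\<close>
      by (simp add: open_interval_base)
  next
    case False
    have ab: "less_on V le a b"
      using pair carrier by (simp add: less_on_def)
    have "a \<in> open_interval W le p q \<or> b \<in> open_interval W le p q"
      using False \<open>le p a \<and> le b q\<close> assms(1,2) pair carrier
        less_on_le_trans[OF ab, of q] le_less_on_trans[OF _ ab, of p]
      by (auto simp: open_interval_def less_on_def)
    then obtain z where "z \<in> open_interval W le p q" "z = a \<or> z = b"
      by blast
    moreover from this have "le c z \<or> le z c" if "c \<in> C" for c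
      using that below_iff[of a c] above_iff[of b c] le_refl pair carrier by blast
    ultimately show ?thesis
      using components_le_Un_comparable[OF assms(3)] assms(1,2) True False
      by (auto simp: open_interval_base)
  qed
qed

lemma less_on_chain: "c \<in> C \<Longrightarrow> less_on V le a c" "c \<in> C \<Longrightarrow> less_on V le c b"
  using below_iff[of a c] above_iff[of b c] le_refl pair carrier disjoint
  by (auto simp: less_on_def)

lemma components_le_open_interval_from_chain:
  assumes p: "p \<in> C"
  shows "components_le le (open_interval V le p q) 1"
proof (cases "open_interval V le p q \<subseteq> C")
  case True
  then show ?thesis
    using chain by (intro components_le_chain) (auto simp: is_chain_def)
next
  case False
  then obtain w where "w \<notin> C" and w_between: "less_on V le p w" "less_on V le w q"
    by (auto simp: open_interval_def)
  then have "w \<in> W"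
    using carrier by (simp add: less_on_def)
  have b_le: "le b x" if "x \<in> W" "less_on V le p x" for x
    using above_iff[OF that(1) p] that(2) by (simp add: less_on_def)
  have "b \<in> open_interval V le p q"
    using less_on_chain(2)[OF p] le_less_on_trans[OF b_le w_between(2)] \<open>w \<in> W\<close> w_between(1)
      pair carrier
    by (simp add: open_interval_def)
  moreover have "le x b \<or> le b x" if "x \<in> open_interval V le p q" for x
  proof -
    have "x \<in> W \<union> C" "less_on V le p x"
      using that carrier by (auto simp: open_interval_def less_on_def)
    then show ?thesis
      using b_le less_on_chain(2)[of x] unfolding less_on_def by blast
  qed
  ultimately show ?thesis
    by (rule components_le_comparable)
qed

lemma adjunct_poset_conversep: "adjunct_poset V le\<inverse>\<inverse> W C b a"
proof -
  interpret converse: poset V "le\<inverse>\<inverse>"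
    by (rule poset_conversep)
  show ?thesis
    using carrier disjoint pair chain attached
    by unfold_locales (auto simp: is_chain_def attached_def)
qed

lemma components_le_open_interval_to_chain:
  "q \<in> C \<Longrightarrow> components_le le (open_interval V le p q) 1"
  using adjunct_poset.components_le_open_interval_from_chain[OF adjunct_poset_conversep, of q p]
  by simp

end

lemma adjunct_represents_imp_adjunct_poset:
  assumes "adj_valid P [(a, b, C)]" "represents (adjunct P a b C) V le" "poset V le"
  shows "represents P (fst P) le" "adjunct_poset V le (fst P) (set C) a b"
proof -
  have valid: "a \<in> fst P" "b \<in> fst P" "snd P a b" "a \<noteq> b" "set C \<inter> fst P = {}"
    using assms(1) by auto
  have carrier: "V = fst P \<union> set C" and chain: "represents (chain_poset C) (set C) le"
    and attached: "attached le (fst P) a b (set C)" and base: "represents P (fst P) le"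
    using assms(2) unfolding represents_adjunct_iff[OF valid(1,2,5)] by blast+
  show "represents P (fst P) le"
    by (fact base)
  interpret poset V le
    by (fact assms(3))
  show "adjunct_poset V le (fst P) (set C) a b"
    using valid carrier attached base is_chain_if_represents[OF chain]
    by unfold_locales (auto simp: represents_def)
qed

lemma components_le_adj_iter:
  assumes "adj_valid (chain_poset C0) steps" "represents (adj_iter (chain_poset C0) steps) V le"
    and "poset V le" "p \<in> V" "q \<in> V"
  shows "components_le le (open_interval V le p q) (Suc (count_list (adj_pairs steps) (p, q)))"
  using assms
proof (induction steps arbitrary: V p q rule: rev_induct)
  case Nil
  then have "is_chain le (open_interval V le p q)"
    using is_chain_if_represents[of C0 V le]
    by (auto simp: is_chain_def open_interval_def less_on_def)
  then show ?case
    using components_le_chain[of le] by (simp add: adj_pairs_def)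
next
  case (snoc step steps)
  obtain a b C where step: "step = (a, b, C)"
    by (cases step)
  define P where "P = adj_iter (chain_poset C0) steps"
  have valid: "adj_valid (chain_poset C0) steps" "adj_valid P [(a, b, C)]"
    using snoc.prems(1) unfolding adj_valid_append P_def step by blast+
  have "represents (adjunct P a b C) V le"
    using snoc.prems(2) by (simp add: step adj_iter_append P_def)
  note adjunct = adjunct_represents_imp_adjunct_poset[OF valid(2) this snoc.prems(3)]
  interpret adjunct_poset V le "fst P" "set C" a b
    by (fact adjunct(2))
  show ?case
  proof (cases "p \<in> fst P \<and> q \<in> fst P")
    case True
    have "components_le le (open_interval (fst P) le p q) (Suc (count_list (adj_pairs steps) (p, q)))"
      using snoc.IH[OF valid(1)] adjunct(1) True poset_subset carrier unfolding P_def by blast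
    then show ?thesis
      using components_le_open_interval_base True by (fastforce simp: adj_pairs_def step)
  next
    case False
    then have "components_le le (open_interval V le p q) 1"
      using components_le_open_interval_from_chain components_le_open_interval_to_chain
        snoc.prems(4,5) carrier by blast
    then show ?thesis
      by (rule components_le_mono) simp
  qed
qed

definition adj_chains :: "('a \<times> 'a \<times> 'a list) list \<Rightarrow> 'a list list" where
  "adj_chains steps = map (\<lambda>(a, b, C). C) steps"

lemma adj_valid_ConsI:
  assumes P: "represents P W le" and ab: "less_on W le a b" "open_interval W le a b \<noteq> {}"
    and "C \<noteq> []" "distinct C" "set C \<inter> W = {}" "adj_valid (adjunct P a b C) steps"
  shows "adj_valid P ((a, b, C) # steps)"
proof -
  have "fst P = W" and "snd P a b"
    using P ab(1) by (auto simp: represents_def less_on_def)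
  moreover have "\<not> covers W (snd P) a b"
    using P ab by (auto simp: represents_def covers_def open_interval_def less_on_def)
  ultimately show ?thesis
    using assms by (simp add: less_on_def)
qed

lemma adj_valid_represents_adj_iter:
  assumes "represents P W le"
    and "distinct (concat (adj_chains steps))" "set (concat (adj_chains steps)) \<inter> W = {}"
    and "\<And>a b C. (a, b, C) \<in> set steps \<Longrightarrow> less_on W le a b \<and> open_interval W le a b \<noteq> {} \<and>
           C \<noteq> [] \<and> represents (chain_poset C) (set C) le \<and>
           attached le (W \<union> set (concat (adj_chains steps)) - set C) a b (set C)"
  shows "adj_valid P steps \<and> represents (adj_iter P steps) (W \<union> set (concat (adj_chains steps))) le"
  using assms
proof (induction steps arbitrary: P W)
  case Nil
  then show ?case
    by (simp add: adj_chains_def)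
next
  case (Cons step steps)
  obtain a b C where step: "step = (a, b, C)"
    by (cases step)
  have chains: "adj_chains (step # steps) = C # adj_chains steps"
    by (simp add: adj_chains_def step)
  have fresh: "distinct C" "set C \<inter> W = {}"
    using Cons.prems(2,3) by (auto simp: chains)
  have ab: "less_on W le a b" "open_interval W le a b \<noteq> {}" "C \<noteq> []"
    and chain: "represents (chain_poset C) (set C) le"
    and "attached le (W \<union> set (concat (adj_chains (step # steps))) - set C) a b (set C)"
    using Cons.prems(4)[of a b C] by (simp_all add: step)
  then have "attached le W a b (set C)"
    using fresh(2) by (auto simp: attached_def)
  then have "represents (adjunct P a b C) (W \<union> set C) le"
    using ab(1) fresh(2) chain Cons.prems(1)
    by (subst represents_adjunct_iff) (auto simp: represents_def less_on_def)
  then have "adj_valid (adjunct P a b C) steps \<and>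
      represents (adj_iter (adjunct P a b C) steps) (W \<union> set C \<union> set (concat (adj_chains steps))) le"
  proof (rule Cons.IH)
    fix a' b' C'
    assume "(a', b', C') \<in> set steps"
    then show "less_on (W \<union> set C) le a' b' \<and> open_interval (W \<union> set C) le a' b' \<noteq> {} \<and>
        C' \<noteq> [] \<and> represents (chain_poset C') (set C') le \<and>
        attached le (W \<union> set C \<union> set (concat (adj_chains steps)) - set C') a' b' (set C')"
      using Cons.prems(4)[of a' b' C'] by (auto simp: chains open_interval_def less_on_def Un_assoc)
  qed (use Cons.prems(2,3) in \<open>auto simp: chains\<close>)
  moreover from this have "adj_valid P (step # steps)"
    unfolding step using adj_valid_ConsI[OF Cons.prems(1) ab fresh] by blast
  ultimately show ?case
    unfolding chains by (simp add: step Un_assoc)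
qed

section \<open>Index pairs\<close>

definition index_pairs :: "nat \<Rightarrow> (nat \<times> nat) set" where
  "index_pairs n = {(i, j). 1 \<le> i \<and> i < j \<and> j \<le> n}"

lemma finite_index_pairs: "finite (index_pairs n)"
  by (rule finite_subset[of _ "{1..n} \<times> {1..n}"]) (auto simp: index_pairs_def)

lemma Suc_in_index_pairs_iff: "(i, Suc i) \<in> index_pairs n \<longleftrightarrow> i \<in> {1..<n}"
  by (auto simp: index_pairs_def)

lemma card_index_pairs: "card (index_pairs n) = n choose 2"
proof (induction n)
  case 0
  have "index_pairs 0 = {}"
    by (auto simp: index_pairs_def)
  then show ?case
    by simp
next
  case (Suc n)
  have "index_pairs (Suc n) = index_pairs n \<union> (\<lambda>i. (i, Suc n)) ` {1..n}"
    by (auto simp: index_pairs_def le_Suc_eq)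
  moreover have "index_pairs n \<inter> (\<lambda>i. (i, Suc n)) ` {1..n} = {}"
    by (auto simp: index_pairs_def)
  moreover have "card ((\<lambda>i. (i, Suc n)) ` {1..n}) = n"
    by (simp add: card_image inj_on_def)
  ultimately show ?case
    using Suc finite_index_pairs by (simp add: card_Un_disjoint numeral_2_eq_2)
qed

lemma sum_index_pairs_consecutive:
  "(\<Sum>(i, j)\<in>index_pairs n. 1 + of_bool (j = Suc i)) = (n choose 2) + (n - 1)"
proof -
  have "index_pairs n \<inter> {(i, j). j = Suc i} = (\<lambda>i. (i, Suc i)) ` {1..<n}"
    by (auto simp: index_pairs_def)
  then have "(\<Sum>(i, j)\<in>index_pairs n. of_bool (j = Suc i)) = n - 1"
    using finite_index_pairs
    by (simp add: case_prod_unfold of_bool_def sum.If_cases card_image inj_on_def Int_def)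
  then show ?thesis
    by (simp add: case_prod_unfold sum_Suc card_index_pairs)
qed

lemma pair_index_eq_sum:
  assumes "1 \<le> i" "i \<le> n"
  shows "pair_index n i j = (\<Sum>k=1..<i. n - k) + (j - i)"
proof -
  have "(i - 1) * n = (\<Sum>k=1..<i. n - k) + (i choose 2)"
    using assms
  proof (induction i rule: dec_induct)
    case base
    then show ?case
      by simp
  next
    case (step i)
    then show ?case
      by (cases i) (auto simp: numeral_2_eq_2)
  qed
  then show ?thesis
    by (simp add: pair_index_def)
qed

lemma pair_index_less:
  assumes "(i, j) \<in> index_pairs n" "(i', j') \<in> index_pairs n" "i < i'"
  shows "pair_index n i j < pair_index n i' j'"
proof -
  have ij: "1 \<le> i" "i < j" "j \<le> n" and ij': "1 \<le> i'" "i' < j'" "j' \<le> n"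
    using assms(1,2) by (auto simp: index_pairs_def)
  have "pair_index n i j \<le> (\<Sum>k=1..<Suc i. n - k)"
    using ij by (simp add: pair_index_eq_sum)
  also have "\<dots> \<le> (\<Sum>k=1..<i'. n - k)"
    using assms(3) by (intro sum_mono2) auto
  also have "\<dots> < pair_index n i' j'"
    using ij' by (simp add: pair_index_eq_sum)
  finally show ?thesis .
qed

lemma inj_on_pair_index: "inj_on (\<lambda>(i, j). pair_index n i j) (index_pairs n)"
proof (rule inj_onI, clarify)
  fix i j i' j'
  assume pairs: "(i, j) \<in> index_pairs n" "(i', j') \<in> index_pairs n"
    and eq: "pair_index n i j = pair_index n i' j'"
  have "i = i'"
    using pair_index_less[OF pairs] pair_index_less[OF pairs(2,1)] eq
    by (metis less_irrefl nat_neq_iff)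
  moreover from this have "j = j'"
    using eq pairs by (auto simp: pair_index_def index_pairs_def)
  ultimately show "i = i' \<and> j = j'"
    by blast
qed

definition index_pair_list :: "nat \<Rightarrow> (nat \<times> nat) list" where
  "index_pair_list n = concat (map (\<lambda>i. map (Pair i) [Suc i..<Suc n]) [1..<n])"

lemma set_index_pair_list: "set (index_pair_list n) = index_pairs n"
  by (force simp: index_pair_list_def index_pairs_def simp del: upt_Suc)

lemma distinct_index_pair_list: "distinct (index_pair_list n)"
  unfolding index_pair_list_def
proof (rule distinct_concat)
  have "i = j" if "i \<in> {1..<n}"
    and "map (Pair i) [Suc i..<Suc n] = map (Pair j) [Suc j..<Suc n]" for i j
  proof -
    have "(i, n) \<in> set (map (Pair i) [Suc i..<Suc n])"
      using that(1) by auto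
    then show ?thesis
      unfolding that(2) by auto
  qed
  then show "distinct (map (\<lambda>i. map (Pair i) [Suc i..<Suc n]) [1..<n])"
    by (simp add: distinct_map inj_on_def del: upt_Suc)
qed (auto simp: distinct_map inj_on_def simp del: upt_Suc)

lemma CF_steps_eq_map:
  "CF_steps n u c = map (\<lambda>(i, j). (u i, u j, [c (pair_index n i j)])) (index_pair_list n)"
  by (simp add: CF_steps_def index_pair_list_def map_concat comp_def)

lemma concat_adj_chains_CF_steps:
  "concat (adj_chains (CF_steps n u c)) = map (\<lambda>(i, j). c (pair_index n i j)) (index_pair_list n)"
  by (simp add: CF_steps_eq_map adj_chains_def case_prod_unfold comp_def)

lemma set_adj_chains_CF_steps:
  "set (concat (adj_chains (CF_steps n u c))) = (\<lambda>(i, j). c (pair_index n i j)) ` index_pairs n"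
  unfolding concat_adj_chains_CF_steps by (simp add: set_index_pair_list)

lemma CF_chain_Suc: "1 \<le> m \<Longrightarrow> CF_chain (Suc m) u x = CF_chain m u x @ [x m, u (Suc m)]"
  by (simp add: CF_chain_def)

lemma last_CF_chain: "last (CF_chain n u x) = u n"
  by (simp add: CF_chain_def)

lemma set_CF_chain: "1 \<le> n \<Longrightarrow> set (CF_chain n u x) = u ` {1..n} \<union> x ` {1..<n}"
proof (induction n rule: dec_induct)
  case base
  then show ?case
    by (simp add: CF_chain_def)
next
  case (step m)
  then show ?case
    by (auto simp: CF_chain_Suc atLeastAtMostSuc_conv atLeastLessThanSuc)
qed

lemma successively_CF_chain:
  assumes "1 \<le> n" "\<And>i. i \<in> {1..<n} \<Longrightarrow> R (u i) (x i) \<and> R (x i) (u (Suc i))"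
  shows "successively R (CF_chain n u x)"
  using assms
proof (induction n rule: dec_induct)
  case base
  then show ?case
    by (simp add: CF_chain_def)
next
  case (step m)
  then show ?case
    using last_CF_chain[of m u x] by (simp add: CF_chain_Suc successively_append_iff)
qed

section \<open>Links between reducible elements\<close>

definition links :: "'a set \<Rightarrow> ('a \<Rightarrow> 'a \<Rightarrow> bool) \<Rightarrow> 'a \<Rightarrow> 'a \<Rightarrow> 'a set" where
  "links V le p q = {x \<in> irreducibles V le. covers V le p x \<and> covers V le x q}"

definition reducible_pairs :: "'a set \<Rightarrow> ('a \<Rightarrow> 'a \<Rightarrow> bool) \<Rightarrow> ('a \<times> 'a) set" where
  "reducible_pairs V le = {(p, q). p \<in> reducibles V le \<and> q \<in> reducibles V le \<and> less_on V le p q}"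

lemma links_subset_open_interval: "links V le p q \<subseteq> open_interval V le p q"
  by (auto simp: links_def open_interval_def dest: covers_imp_less_on)

lemma links_empty_if_covers: "covers V le p q \<Longrightarrow> links V le p q = {}"
  using links_subset_open_interval[of V le p q] by (simp add: covers_iff_open_interval_empty)

lemma card_links_le_components:
  assumes "components_le le (open_interval V le p q) m"
  shows "card (links V le p q) + of_bool (links V le p q \<noteq> open_interval V le p q) \<le> m"
proof (rule card_isolated_le_components[OF assms links_subset_open_interval])
  fix x y
  assume "x \<in> links V le p q" "y \<in> open_interval V le p q" "le x y \<or> le y x"
  then show "y = x"
    unfolding links_def covers_def open_interval_def less_on_def by blast
qed

locale linked_poset = finite_poset +
  assumes irreducible_covers: "x \<in> irreducibles V le \<Longrightarrow>
    \<exists>p\<in>reducibles V le. \<exists>q\<in>reducibles V le. {z. covers V le z x} = {p} \<and> {z. covers V le x z} = {q}"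
begin

lemma finite_irreducibles: "finite (irreducibles V le)"
  using finite_carrier by (simp add: irreducibles_def)

lemma finite_links: "finite (links V le p q)"
  using finite_irreducibles by (simp add: links_def)

lemma finite_reducible_pairs: "finite (reducible_pairs V le)"
  by (rule finite_subset[of _ "V \<times> V"]) (auto simp: reducible_pairs_def less_on_def finite_carrier)

lemma covers_link_iff:
  assumes "x \<in> links V le p q"
  shows "covers V le z x \<longleftrightarrow> z = p" "covers V le x z \<longleftrightarrow> z = q"
  using irreducible_covers[of x] assms by (auto simp: links_def set_eq_iff)

lemma le_link_iff:
  assumes "x \<in> links V le p q" "w \<in> V" "w \<noteq> x"
  shows "le w x \<longleftrightarrow> le w p" "le x w \<longleftrightarrow> le q w"
proof -
  have x: "x \<in> V" "p \<in> V" "q \<in> V" "le p x" "le x q"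
    using assms(1) by (auto simp: links_def covers_def)
  show "le w x \<longleftrightarrow> le w p"
    using exists_lower_cover[of w x] covers_link_iff(1)[OF assms(1)] le_trans[of w p x] x assms(2,3)
    unfolding less_on_def by metis
  show "le x w \<longleftrightarrow> le q w"
    using exists_upper_cover[of x w] covers_link_iff(2)[OF assms(1)] le_trans[of x q w] x assms(2,3)
    unfolding less_on_def by metis
qed

lemma links_disjoint:
  assumes "x \<in> links V le p q" "x \<in> links V le p' q'"
  shows "(p, q) = (p', q')"
  using assms(2) covers_link_iff[OF assms(1)] by (auto simp: links_def)

lemma irreducibles_eq_UN_links:
  "irreducibles V le = (\<Union>(p, q)\<in>reducible_pairs V le. links V le p q)"
proof (intro equalityI subsetI)
  fix x
  assume x: "x \<in> irreducibles V le"
  then obtain p q where pq: "p \<in> reducibles V le" "q \<in> reducibles V le"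
    and px: "covers V le p x" and xq: "covers V le x q"
    using irreducible_covers by blast
  have "less_on V le p q"
    using less_on_trans covers_imp_less_on px xq by metis
  then have "(p, q) \<in> reducible_pairs V le"
    using pq by (simp add: reducible_pairs_def)
  moreover have "x \<in> links V le p q"
    using x px xq by (simp add: links_def)
  ultimately show "x \<in> (\<Union>(p, q)\<in>reducible_pairs V le. links V le p q)"
    by blast
qed (auto simp: links_def)

lemma card_irreducibles:
  "card (irreducibles V le) = (\<Sum>(p, q)\<in>reducible_pairs V le. card (links V le p q))"
  unfolding irreducibles_eq_UN_links
proof (subst card_UN_disjoint)
  show "\<forall>s\<in>reducible_pairs V le. \<forall>t\<in>reducible_pairs V le. s \<noteq> t \<longrightarrow>
      (case s of (p, q) \<Rightarrow> links V le p q) \<inter> (case t of (p, q) \<Rightarrow> links V le p q) = {}"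
    using links_disjoint by fast
qed (use finite_reducible_pairs finite_links in \<open>auto simp: case_prod_unfold\<close>)

lemma card_carrier: "card V = card (reducibles V le) + card (irreducibles V le)"
  using card_Un_disjoint[OF _ _ reducibles_Int_irreducibles[of V le]] finite_carrier
    reducibles_Un_irreducibles[of V le] by (metis finite_Un)

lemma card_coverings:
  "card (coverings V le) =
    2 * card (irreducibles V le) + (\<Sum>(p, q)\<in>reducible_pairs V le. of_bool (covers V le p q))"
proof -
  let ?I = "irreducibles V le" and ?R = "reducibles V le"
  let ?between = "{(p, q) \<in> reducible_pairs V le. covers V le p q}"
  obtain lower upper where reducible: "\<And>x. x \<in> ?I \<Longrightarrow> lower x \<in> ?R \<and> upper x \<in> ?R"
    and covers: "\<And>x z. x \<in> ?I \<Longrightarrow> (covers V le z x \<longleftrightarrow> z = lower x) \<and> (covers V le x z \<longleftrightarrow> z = upper x)"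
    using irreducible_covers by (simp add: set_eq_iff) metis
  let ?below = "(\<lambda>x. (lower x, x)) ` ?I" and ?above = "(\<lambda>x. (x, upper x)) ` ?I"
  have "(a, b) \<in> coverings V le \<longleftrightarrow> (a, b) \<in> ?below \<union> ?above \<union> ?between" for a b
  proof (cases "a \<in> ?I \<or> b \<in> ?I")
    case True
    then show ?thesis
      using covers reducibles_Int_irreducibles[of V le]
      by (auto simp: coverings_def reducible_pairs_def)
  next
    case False
    then have "covers V le a b \<Longrightarrow> a \<in> ?R \<and> b \<in> ?R"
      using reducibles_Un_irreducibles[of V le] by (auto simp: covers_def)
    then show ?thesis
      using False covers_imp_less_on[of V le a b] by (auto simp: coverings_def reducible_pairs_def)
  qed
  then have "coverings V le = ?below \<union> ?above \<union> ?between"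
    by auto
  moreover have "(?below \<union> ?above) \<inter> ?between = {}" "?below \<inter> ?above = {}"
    using reducibles_Int_irreducibles[of V le] reducible by (auto simp: reducible_pairs_def)
  moreover have "finite ?between" "finite ?below" "finite ?above"
    using finite_reducible_pairs finite_irreducibles by (auto intro: finite_subset)
  moreover have "card ?below = card ?I" "card ?above = card ?I"
    by (simp_all add: card_image inj_on_def)
  moreover have "card ?between = (\<Sum>(p, q)\<in>reducible_pairs V le. of_bool (covers V le p q))"
    using finite_reducible_pairs
    by (simp add: case_prod_unfold of_bool_def sum.If_cases Int_def)
  ultimately show ?thesis
    by (simp add: card_Un_disjoint)
qed

lemma nullity_eq_sum_links:
  assumes "num_components V le = 1"
  shows "nullity V le =
    int (\<Sum>(p, q)\<in>reducible_pairs V le. card (links V le p q) + of_bool (covers V le p q)) - int (card (reducibles V le)) + 1"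
  using assms unfolding nullity_def card_cover_edges card_coverings card_carrier
  by (simp add: case_prod_unfold sum.distrib card_irreducibles)

end

section \<open>Blocks of maximal nullity\<close>

locale reducible_chain = linked_poset +
  fixes n :: nat and u :: "nat \<Rightarrow> 'a"
  assumes reducibles_eq: "reducibles V le = u ` {1..n}"
    and less_on_u: "1 \<le> i \<Longrightarrow> i < j \<Longrightarrow> j \<le> n \<Longrightarrow> less_on V le (u i) (u j)"
begin

lemma u_reducible: "i \<in> {1..n} \<Longrightarrow> u i \<in> reducibles V le"
  using reducibles_eq by blast

lemma inj_on_u: "inj_on u {1..n}"
  by (rule linorder_inj_onI) (use less_on_u in \<open>auto simp: less_on_def\<close>)

lemma card_reducibles: "card (reducibles V le) = n"
  unfolding reducibles_eq card_image[OF inj_on_u] by simp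

lemma less_on_u_iff:
  assumes "i \<in> {1..n}" "j \<in> {1..n}"
  shows "less_on V le (u i) (u j) \<longleftrightarrow> i < j"
proof
  assume "less_on V le (u i) (u j)"
  then have "\<not> less_on V le (u j) (u i)" "u i \<noteq> u j"
    using asymp_less_on by (auto simp: less_on_def dest: asympD)
  then show "i < j"
    using less_on_u[of j i] assms by (cases i j rule: linorder_cases) auto
qed (use less_on_u assms in auto)

lemma bij_betw_reducible_pairs:
  "bij_betw (\<lambda>(i, j). (u i, u j)) (index_pairs n) (reducible_pairs V le)"
proof (rule bij_betwI')
  fix s t assume "s \<in> index_pairs n" "t \<in> index_pairs n"
  then show "(case s of (i, j) \<Rightarrow> (u i, u j)) = (case t of (i, j) \<Rightarrow> (u i, u j)) \<longleftrightarrow> s = t"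
    using inj_on_u by (auto simp: index_pairs_def inj_on_eq_iff)
next
  fix s assume "s \<in> index_pairs n"
  then show "(case s of (i, j) \<Rightarrow> (u i, u j)) \<in> reducible_pairs V le"
    using u_reducible less_on_u by (auto simp: index_pairs_def reducible_pairs_def)
next
  fix t assume "t \<in> reducible_pairs V le"
  then obtain i j where "i \<in> {1..n}" "j \<in> {1..n}" "t = (u i, u j)" "less_on V le (u i) (u j)"
    by (auto simp: reducible_pairs_def reducibles_eq)
  then show "\<exists>s\<in>index_pairs n. t = (case s of (i, j) \<Rightarrow> (u i, u j))"
    using less_on_u_iff by (intro bexI[of _ "(i, j)"]) (auto simp: index_pairs_def)
qed

lemma sum_reducible_pairs:
  "(\<Sum>(p, q)\<in>reducible_pairs V le. f p q) = (\<Sum>(i, j)\<in>index_pairs n. f (u i) (u j))"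
  using sum.reindex_bij_betw[OF bij_betw_reducible_pairs, of "\<lambda>(p, q). f p q"]
  by (simp add: case_prod_unfold)

lemma u_Suc_between:
  assumes "(i, j) \<in> index_pairs n" "j \<noteq> Suc i"
  shows "u (Suc i) \<in> open_interval V le (u i) (u j)"
  using assms less_on_u by (auto simp: open_interval_def index_pairs_def)

lemma card_links_plus_covers_le:
  assumes "components_le le (open_interval V le (u i) (u j)) 2" "(i, j) \<in> index_pairs n"
  shows "card (links V le (u i) (u j)) + of_bool (covers V le (u i) (u j)) \<le> 1 + of_bool (j = Suc i)"
proof (cases "j = Suc i")
  case True
  then show ?thesis
    using card_links_le_components[OF assms(1)] links_empty_if_covers[of V le "u i" "u j"] by auto
next
  case False
  then have between: "u (Suc i) \<in> open_interval V le (u i) (u j)"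
    using assms(2) by (rule u_Suc_between[rotated])
  then have "\<not> covers V le (u i) (u j)"
    by (auto simp: covers_iff_open_interval_empty)
  moreover have "u (Suc i) \<notin> links V le (u i) (u j)"
    using u_reducible[of "Suc i"] assms(2) by (auto simp: links_def irreducibles_def index_pairs_def)
  then have "links V le (u i) (u j) \<noteq> open_interval V le (u i) (u j)"
    using between by blast
  ultimately show ?thesis
    using card_links_le_components[OF assms(1)] False by simp
qed

lemma card_links_eq_if_nullity_max:
  assumes "num_components V le = 1" "nullity V le = int (n choose 2)" "1 \<le> n"
    and components: "\<And>p q. p \<in> V \<Longrightarrow> q \<in> V \<Longrightarrow> components_le le (open_interval V le p q) 2"
    and ij: "(i, j) \<in> index_pairs n"
  shows "card (links V le (u i) (u j)) = 1 + of_bool (j = Suc i)"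
proof -
  let ?f = "\<lambda>(i, j). card (links V le (u i) (u j)) + of_bool (covers V le (u i) (u j))"
  let ?g = "\<lambda>(i, j). 1 + of_bool (j = Suc i) :: nat"
  have "sum ?f (index_pairs n) = (n choose 2) + (n - 1)"
    using nullity_eq_sum_links[OF assms(1)] assms(2,3)
    unfolding sum_reducible_pairs card_reducibles by linarith
  then have sums: "sum ?f (index_pairs n) = sum ?g (index_pairs n)"
    unfolding sum_index_pairs_consecutive .
  have bound: "?f s \<le> ?g s" if s: "s \<in> index_pairs n" for s
  proof -
    obtain i j where "s = (i, j)" "u i \<in> V" "u j \<in> V"
      using s u_reducible by (cases s) (auto simp: index_pairs_def reducibles_def)
    then show ?thesis
      using card_links_plus_covers_le[of i j] components s by simp
  qed
  have eq: "card (links V le (u i) (u j)) + of_bool (covers V le (u i) (u j)) = 1 + of_bool (j = Suc i)"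
    using sum_mono_inv[OF sums bound ij finite_index_pairs] by simp
  have "\<not> covers V le (u i) (u j)"
  proof
    assume covers: "covers V le (u i) (u j)"
    then have "links V le (u i) (u j) = {}"
      by (rule links_empty_if_covers)
    moreover have "j = Suc i"
      using covers u_Suc_between[OF ij] by (auto simp: covers_iff_open_interval_empty)
    ultimately show False
      using eq covers by simp
  qed
  then show ?thesis
    using eq by simp
qed

end

locale complete_block = reducible_chain +
  assumes n_pos: "1 \<le> n"
    and card_links: "(i, j) \<in> index_pairs n \<Longrightarrow> card (links V le (u i) (u j)) = 1 + of_bool (j = Suc i)"
begin

lemma card_irreducibles_eq: "card (irreducibles V le) = (n choose 2) + (n - 1)"
proof -
  have "card (irreducibles V le) = (\<Sum>(i, j)\<in>index_pairs n. 1 + of_bool (j = Suc i))"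
    unfolding card_irreducibles sum_reducible_pairs by (rule sum.cong) (auto simp: card_links)
  also have "\<dots> = (n choose 2) + (n - 1)"
    by (rule sum_index_pairs_consecutive)
  finally show ?thesis .
qed

lemma card_carrier_eq: "card V = 2 * n - 1 + (n choose 2)"
  using card_carrier card_reducibles card_irreducibles_eq n_pos by simp

lemma card_coverings_eq: "card (coverings V le) = (2 * n - 2) + 2 * (n choose 2)"
proof -
  have "\<not> covers V le (u i) (u j)" if "(i, j) \<in> index_pairs n" for i j
    using card_links[OF that] links_empty_if_covers by fastforce
  then have "(\<Sum>(p, q)\<in>reducible_pairs V le. of_bool (covers V le p q)) = (0 :: nat)"
    unfolding sum_reducible_pairs by (intro sum.neutral) auto
  then show ?thesis
    using card_coverings card_irreducibles_eq by simp
qed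

end

locale labelled_block = complete_block +
  fixes x c :: "nat \<Rightarrow> 'a"
  assumes links_eq: "(i, j) \<in> index_pairs n \<Longrightarrow>
      links V le (u i) (u j) = insert (c (pair_index n i j)) (if j = Suc i then {x i} else {})"
    and x_neq_c: "i \<in> {1..<n} \<Longrightarrow> x i \<noteq> c (pair_index n i (Suc i))"
begin

lemma c_in_links: "(i, j) \<in> index_pairs n \<Longrightarrow> c (pair_index n i j) \<in> links V le (u i) (u j)"
  by (simp add: links_eq)

lemma x_in_links: "i \<in> {1..<n} \<Longrightarrow> x i \<in> links V le (u i) (u (Suc i))"
  using links_eq[of i "Suc i"] by (simp add: Suc_in_index_pairs_iff)

lemma less_on_x: "i \<in> {1..<n} \<Longrightarrow> less_on V le (u i) (x i) \<and> less_on V le (x i) (u (Suc i))"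
  using x_in_links by (auto simp: links_def dest: covers_imp_less_on)

lemma links_index_unique:
  assumes "v \<in> links V le (u i) (u j)" "v \<in> links V le (u i') (u j')"
    and "(i, j) \<in> index_pairs n" "(i', j') \<in> index_pairs n"
  shows "i = i' \<and> j = j'"
  using links_disjoint[OF assms(1,2)] assms(3,4) inj_on_u
  by (auto simp: index_pairs_def inj_on_eq_iff)

lemma c_neq_x:
  assumes "(i, j) \<in> index_pairs n" "k \<in> {1..<n}"
  shows "c (pair_index n i j) \<noteq> x k"
  using links_index_unique[OF c_in_links[OF assms(1)], of k "Suc k"] x_in_links[OF assms(2)]
    x_neq_c[OF assms(2)] assms Suc_in_index_pairs_iff by metis

lemma incomparable_x_c:
  assumes "(i, j) \<in> index_pairs n"
  shows "incomparable le (x i) (c (pair_index n i j))"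
proof -
  have i: "i \<in> {1..<n}"
    using assms by (auto simp: index_pairs_def)
  have "covers V le (u i) (x i)" "covers V le (u i) (c (pair_index n i j))"
    using x_in_links[OF i] c_in_links[OF assms] by (auto simp: links_def)
  then show ?thesis
    using upper_covers_comparable_eq c_neq_x[OF assms i] unfolding incomparable_def by metis
qed

lemma inj_on_c: "inj_on (\<lambda>(i, j). c (pair_index n i j)) (index_pairs n)"
proof (rule inj_onI, clarify)
  fix i j i' j'
  assume "(i, j) \<in> index_pairs n" "(i', j') \<in> index_pairs n"
    and "c (pair_index n i j) = c (pair_index n i' j')"
  then show "i = i' \<and> j = j'"
    using links_index_unique c_in_links by metis
qed

lemma irreducibles_labelled:
  "irreducibles V le = x ` {1..<n} \<union> (\<lambda>(i, j). c (pair_index n i j)) ` index_pairs n"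
proof
  show "irreducibles V le \<subseteq> x ` {1..<n} \<union> (\<lambda>(i, j). c (pair_index n i j)) ` index_pairs n"
  proof
    fix v
    assume "v \<in> irreducibles V le"
    then obtain i j where ij: "(i, j) \<in> index_pairs n" "v \<in> links V le (u i) (u j)"
      unfolding irreducibles_eq_UN_links bij_betw_imp_surj_on[OF bij_betw_reducible_pairs, symmetric]
      by auto
    then consider "v = c (pair_index n i j)" | "j = Suc i" "v = x i"
      by (auto simp: links_eq split: if_splits)
    then show "v \<in> x ` {1..<n} \<union> (\<lambda>(i, j). c (pair_index n i j)) ` index_pairs n"
      using ij(1) Suc_in_index_pairs_iff by cases (force, blast)
  qed
  show "x ` {1..<n} \<union> (\<lambda>(i, j). c (pair_index n i j)) ` index_pairs n \<subseteq> irreducibles V le"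
    using x_in_links c_in_links unfolding links_def by fast
qed

lemma set_CF_chain_eq: "set (CF_chain n u x) = reducibles V le \<union> x ` {1..<n}"
  using set_CF_chain[OF n_pos] reducibles_eq by simp

lemma carrier_labelled:
  "V = set (CF_chain n u x) \<union> (\<lambda>(i, j). c (pair_index n i j)) ` index_pairs n"
  using reducibles_Un_irreducibles[of V le] irreducibles_labelled set_CF_chain_eq by auto

lemma CF_chain_subset: "set (CF_chain n u x) \<subseteq> V"
  using carrier_labelled by blast

lemma c_notin_CF_chain:
  assumes "(i, j) \<in> index_pairs n"
  shows "c (pair_index n i j) \<notin> set (CF_chain n u x)"
  using c_in_links[OF assms] c_neq_x[OF assms]
  unfolding set_CF_chain_eq links_def irreducibles_def by blast

lemma CF_chain_sorted: "sorted_wrt (less_on V le) (CF_chain n u x)"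
  using successively_CF_chain[OF n_pos, of "less_on V le"] less_on_x
  by (simp add: successively_conv_sorted_wrt transp_less_on)

lemma CF_chain_open_interval:
  assumes "(i, j) \<in> index_pairs n"
  shows "less_on (set (CF_chain n u x)) le (u i) (u j)"
    and "x i \<in> open_interval (set (CF_chain n u x)) le (u i) (u j)"
proof -
  have ij: "i \<in> {1..<n}" "i \<in> {1..n}" "j \<in> {1..n}" "Suc i \<le> j" "1 \<le> i"
    using assms by (auto simp: index_pairs_def)
  have in_chain: "u i \<in> set (CF_chain n u x)" "u j \<in> set (CF_chain n u x)" "x i \<in> set (CF_chain n u x)"
    using u_reducible ij by (auto simp: set_CF_chain_eq)
  have "less_on V le (x i) (u j)"
    using less_on_x[OF ij(1)] less_on_trans[of "x i" "u (Suc i)" "u j"]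
      less_on_u[of "Suc i" j] ij(3,4)
    by (cases "j = Suc i") auto
  then show "x i \<in> open_interval (set (CF_chain n u x)) le (u i) (u j)"
    using less_on_x[OF ij(1)] in_chain by (simp add: open_interval_def less_on_def)
  show "less_on (set (CF_chain n u x)) le (u i) (u j)"
    using less_on_u[of i j] in_chain ij by (simp add: less_on_def)
qed

lemma CF_chain_represents: "represents (chain_poset (CF_chain n u x)) (set (CF_chain n u x)) le"
  using CF_chain_sorted CF_chain_subset by (rule represents_chain_poset)

lemma CF_chain_maximal: "maximal_chain V le (set (CF_chain n u x))"
  unfolding maximal_chain_def
proof (intro conjI allI impI)
  show "set (CF_chain n u x) \<subseteq> V"
    by (rule CF_chain_subset)
  show "is_chain le (set (CF_chain n u x))"
    using CF_chain_represents by (rule is_chain_if_represents)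
next
  fix T
  assume T: "set (CF_chain n u x) \<subset> T \<and> T \<subseteq> V"
  then obtain v where "v \<in> T" "v \<in> (\<lambda>(i, j). c (pair_index n i j)) ` index_pairs n"
    using carrier_labelled by blast
  then obtain i j where ij: "(i, j) \<in> index_pairs n" "c (pair_index n i j) \<in> T"
    by auto
  moreover have "i \<in> {1..<n}"
    using ij(1) by (auto simp: index_pairs_def)
  then have "x i \<in> T"
    using T unfolding set_CF_chain_eq by blast
  ultimately show "\<not> is_chain le T"
    using incomparable_x_c unfolding incomparable_def is_chain_def by blast
qed

lemma c_attached:
  assumes "(i, j) \<in> index_pairs n"
  shows "attached le (V - {c (pair_index n i j)}) (u i) (u j) {c (pair_index n i j)}"
  using le_link_iff[OF c_in_links[OF assms]] by (auto simp: attached_def)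

lemma adj_rep_CF: "adj_rep V le (CF_chain n u x) (CF_steps n u c)"
proof -
  let ?C = "CF_chain n u x" and ?steps = "CF_steps n u c"
  have carrier: "set ?C \<union> set (concat (adj_chains ?steps)) = V"
    unfolding set_adj_chains_CF_steps by (rule carrier_labelled[symmetric])
  have "adj_valid (chain_poset ?C) ?steps \<and>
      represents (adj_iter (chain_poset ?C) ?steps) (set ?C \<union> set (concat (adj_chains ?steps))) le"
  proof (rule adj_valid_represents_adj_iter)
    show "represents (chain_poset ?C) (set ?C) le"
      by (rule CF_chain_represents)
    show "distinct (concat (adj_chains ?steps))"
      unfolding concat_adj_chains_CF_steps
      using distinct_index_pair_list inj_on_c by (simp add: distinct_map set_index_pair_list)
    show "set (concat (adj_chains ?steps)) \<inter> set ?C = {}"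
      unfolding set_adj_chains_CF_steps using c_notin_CF_chain by auto
  next
    fix a b D
    assume "(a, b, D) \<in> set ?steps"
    then obtain i j where ij: "(i, j) \<in> index_pairs n"
      and abD: "a = u i" "b = u j" "D = [c (pair_index n i j)]"
      by (auto simp: CF_steps_eq_map set_index_pair_list)
    have "represents (chain_poset D) (set D) le"
      using c_in_links[OF ij]
      by (intro represents_chain_poset) (auto simp: abD links_def irreducibles_def)
    then show "less_on (set ?C) le a b \<and> open_interval (set ?C) le a b \<noteq> {} \<and> D \<noteq> [] \<and>
        represents (chain_poset D) (set D) le \<and>
        attached le (set ?C \<union> set (concat (adj_chains ?steps)) - set D) a b (set D)"
      unfolding carrier using CF_chain_open_interval[OF ij] c_attached[OF ij] abD by auto
  qed
  then show ?thesis
    using CF_chain_maximal distinct_if_sorted_wrt_less_on[OF CF_chain_sorted]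
    unfolding carrier adj_rep_def represents_def by (auto simp: CF_chain_def)
qed

end

lemma (in complete_block) exists_labelling: "\<exists>x c. labelled_block V le n u x c"
proof -
  have "\<exists>d y. links V le (u i) (u j) = insert d (if j = Suc i then {y} else {}) \<and> (j = Suc i \<longrightarrow> y \<noteq> d)"
    if "(i, j) \<in> index_pairs n" for i j
  proof (cases "j = Suc i")
    case True
    then have "card (links V le (u i) (u j)) = 2"
      using card_links[OF that] by simp
    then obtain d y where "links V le (u i) (u j) = {d, y}" "y \<noteq> d"
      by (auto simp: card_2_iff)
    then show ?thesis
      using True by auto
  next
    case False
    then show ?thesis
      using card_links[OF that] by (simp add: card_1_singleton_iff)
  qed
  then obtain d y where links_dy: "\<And>i j. (i, j) \<in> index_pairs n \<Longrightarrow>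
      links V le (u i) (u j) = insert (d i j) (if j = Suc i then {y i j} else {}) \<and>
      (j = Suc i \<longrightarrow> y i j \<noteq> d i j)"
    by metis
  define c where "c k = case_prod d (inv_into (index_pairs n) (\<lambda>(i, j). pair_index n i j) k)" for k
  have c_eq: "c (pair_index n i j) = d i j" if "(i, j) \<in> index_pairs n" for i j
    using inv_into_f_f[OF inj_on_pair_index that] by (simp add: c_def)
  have "labelled_block V le n u (\<lambda>i. y i (Suc i)) c"
  proof unfold_locales
    show "links V le (u i) (u j) =
        insert (c (pair_index n i j)) (if j = Suc i then {y i (Suc i)} else {})"
      if "(i, j) \<in> index_pairs n" for i j
      using links_dy[OF that] c_eq[OF that] by auto
    show "y i (Suc i) \<noteq> c (pair_index n i (Suc i))" if "i \<in> {1..<n}" for i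
      using links_dy[of i "Suc i"] c_eq[of i "Suc i"] that by (simp add: Suc_in_index_pairs_iff)
  qed
  then show ?thesis
    by blast
qed

section \<open>Fundamental basic blocks\<close>

lemma (in lattice_poset) basic_block_linked_poset:
  assumes "basic_block V le" "2 \<le> card V"
  shows "linked_poset V le"
proof unfold_locales
  fix x
  assume "x \<in> irreducibles V le"
  moreover have "V \<noteq> {x}"
    using assms(2) by auto
  ultimately obtain p q where "p \<in> reducibles V le" "q \<in> reducibles V le"
    "{z. covers V le z x} = {p}" "{z. covers V le x z} = {q}"
    using basic_block_irreducible_covers[OF assms(1)] by blast
  then show "\<exists>p\<in>reducibles V le. \<exists>q\<in>reducibles V le.
      {z. covers V le z x} = {p} \<and> {z. covers V le x z} = {q}"
    by blast
qed

lemma fundamental_basic_block_components_le: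
  assumes "fundamental_basic_block V le" "p \<in> V" "q \<in> V"
  shows "components_le le (open_interval V le p q) 2"
proof -
  obtain C0 steps where rep: "adj_rep V le C0 steps" and distinct: "distinct (adj_pairs steps)"
    using assms(1) by (auto simp: fundamental_basic_block_def)
  have "poset V le"
    using assms(1)
    by (simp add: fundamental_basic_block_def RC_lattice_def finite_lattice_def poset_def)
  then have "components_le le (open_interval V le p q) (Suc (count_list (adj_pairs steps) (p, q)))"
    using rep assms(2,3) by (intro components_le_adj_iter) (auto simp: adj_rep_def represents_def)
  moreover have "count_list (adj_pairs steps) (p, q) \<le> 1"
    using distinct card_mono[of "{(p, q)}" "{pq. (p, q) = pq} \<inter> set (adj_pairs steps)"]
    by (auto simp: count_list_eq_length_filter distinct_length_filter)
  ultimately show ?thesis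
    using components_le_mono by fastforce
qed

theorem mainTheorem9:
  fixes V :: "'a set" and le :: "'a \<Rightarrow> 'a \<Rightarrow> bool" and n :: nat and u :: "nat \<Rightarrow> 'a"
  assumes "n \<ge> 2"
    and "fundamental_basic_block V le"
    and "card (reducibles V le) = n"
    and "nullity V le = int (n choose 2)"
    and "reducibles V le = u ` {1..n}"
    and "\<forall>i\<in>{1..n}. \<forall>j\<in>{1..n}. i < j \<longrightarrow> le (u i) (u j) \<and> u i \<noteq> u j"
  shows "\<exists>x c :: nat \<Rightarrow> 'a.
           adj_rep V le (CF_chain n u x) (CF_steps n u c) \<and>
           (\<forall>i\<in>{1..<n}. covers V le (u i) (x i) \<and> covers V le (x i) (u (Suc i)) \<and>
                          incomparable le (x i) (c (pair_index n i (Suc i)))) \<and>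
           card V = 2 * n - 1 + (n choose 2) \<and>
           card (coverings V le) = (2 * n - 2) + 2 * (n choose 2) \<and>
           nullity V le = int (n choose 2)"
proof -
  interpret lattice_poset V le
    using assms(2) by unfold_locales (simp add: fundamental_basic_block_def RC_lattice_def)
  have "card (reducibles V le) \<le> card V"
    using finite_carrier by (intro card_mono) (auto simp: reducibles_def)
  then interpret linked_poset V le
    using assms(1-3) by (intro basic_block_linked_poset) (simp_all add: fundamental_basic_block_def)
  interpret reducible_chain V le n u
    using assms(5,6) by unfold_locales (auto simp: less_on_def reducibles_def)
  interpret complete_block V le n u
    using card_links_eq_if_nullity_max[OF num_components_eq_1 assms(4)]
      fundamental_basic_block_components_le[OF assms(2)] assms(1)
    by unfold_locales auto
  obtain x c where "labelled_block V le n u x c"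
    using exists_labelling by blast
  then interpret labelled_block V le n u x c .
  have "covers V le (u i) (x i) \<and> covers V le (x i) (u (Suc i))" if "i \<in> {1..<n}" for i
    using x_in_links[OF that] by (simp add: links_def)
  then show ?thesis
    using adj_rep_CF incomparable_x_c card_carrier_eq card_coverings_eq assms(4) Suc_in_index_pairs_iff
    by blast
qed

end
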